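(* Let $\Phi=(G,\varphi)$ be a connected $\mathbb{T}$-gain graph on $n$ vertices with maximum vertex degree $\Delta\geq 2$, and let $r(\Phi)$ be the rank of its adjacency matrix $A(\Phi)$. Then $$r(\Phi)\geq\frac{n-2}{\Delta-1}.$$ Equality holds if and only if $\Phi$ is either $(K_{\frac n2,\frac n2},1)$ up to switching equivalence (that is, $G=K_{\frac n2,\frac n2}$ and $\Phi\sim(K_{\frac n2,\frac n2},1)$), or $(C_n,\varphi)$, where $n$ is even and $\varphi(C_n)=\pm 1$.
   Context: Let $\mathbb{T}=\{z\in\mathbb{C}:|z|=1\}$. Let $G$ be a finite simple undirected graph with vertices $v_1,\dots,v_n$. For each edge $e_{s,t}$ joining $v_s$ and $v_t$ there are two oriented edges $\overrightarrow{e_{s,t}}$ (from $v_s$ to $v_t$) and $\overrightarrow{e_{t,s}}$ (from $v_t$ to $v_s$). A $\mathbb{T}$-gain graph (complex unit gain graph) $\Phi=(G,\varphi)$ is a graph $G$ with a function $\varphi$ from oriented edges to $\mathbb{T}$ satisfying $\varphi(\overrightarrow{e_{s,t}})=\varphi(\overrightarrow{e_{t,s}})^{-1}$. It is connected if $G$ is, and its maximum vertex degree is that of $G$. Its adjacency matrix $A(\Phi)$ is the Hermitian $n\times n$ matrix with $(s,t)$ entry $\varphi(\overrightarrow{e_{s,t}})$ if $v_s$ and $v_t$ are adjacent and $0$ otherwise. $C_n$ denotes the cycle on $n$ vertices and $K_{m,n}$ the complete bipartite graph with parts of sizes $m$ and $n$. For a $\mathbb{T}$-gain graph on the cycle $C_n$,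 $\varphi(\overrightarrow{C_n})$ is the product of the gains of the consecutive oriented edges when traversing the cycle in one direction; when this number is real it does not depend on the direction and is written $\varphi(C_n)$. Two $\mathbb{T}$-gain graphs $(G,\varphi_1)$ and $(G,\varphi_2)$ are switching equivalent, written $(G,\varphi_1)\sim(G,\varphi_2)$, if there is $\zeta:V(G)\to\mathbb{T}$ with $\varphi_1(\overrightarrow{e_{i,j}})=\zeta(v_i)^{-1}\varphi_2(\overrightarrow{e_{i,j}})\zeta(v_j)$ for all edges $e_{i,j}$. $(G,1)$ denotes the $\mathbb{T}$-gain graph on $G$ with all gains equal to $1$.
   Formalization: For the cycle case, "φ(C_n)=±1" is corrected to φ(C_n)=(-1)^{n/2}; with the opposite sign equality fails, e.g. C_6 with all gains 1 has rank 6, not 4. *)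

theory Defs
  imports "HOL-Analysis.Analysis" "Graph_Theory.Graph_Theory"
begin

text \<open>
  A finite simple undirected graph is a \<^locale>\<open>pair_graph\<close>, that is, a finite loop-free digraph
  whose arc set is symmetric: every edge contributes its two orientations \<open>(s, t)\<close> and \<open>(t, s)\<close>.
  The vertices are the elements of a finite type, so that the adjacency matrix can be indexed by
  them.  Values of \<open>\<phi>\<close> on pairs that are not arcs are irrelevant.
\<close>

locale gain_graph = pair_graph G
  for G :: "('v::finite) pair_pre_digraph" +
  fixes \<phi> :: "'v \<times> 'v \<Rightarrow> complex"
  assumes verts_UNIV: "pverts G = UNIV"
    and gain_unit: "(s, t) \<in> parcs G \<Longrightarrow> norm (\<phi> (s, t)) = 1"
    and gain_inverse: "(s, t) \<in> parcs G \<Longrightarrow> \<phi> (s, t) = inverse (\<phi> (t, s))"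

definition adjacency_matrix ::
  "('v::finite) pair_pre_digraph \<Rightarrow> ('v \<times> 'v \<Rightarrow> complex) \<Rightarrow> complex ^ 'v ^ 'v" where
  "adjacency_matrix G \<phi> = (\<chi> s t. if (s, t) \<in> parcs G then \<phi> (s, t) else 0)"

text \<open>In a symmetric digraph the out-degree is the degree of the underlying undirected graph.\<close>

definition max_degree :: "'v pair_pre_digraph \<Rightarrow> nat" where
  "max_degree G = Max (out_degree (with_proj G) ` pverts G)"

definition switching_equivalent ::
  "'v pair_pre_digraph \<Rightarrow> ('v \<times> 'v \<Rightarrow> complex) \<Rightarrow> ('v \<times> 'v \<Rightarrow> complex) \<Rightarrow> bool" where
  "switching_equivalent G \<phi>\<^sub>1 \<phi>\<^sub>2 \<longleftrightarrow>
     (\<exists>\<zeta>. (\<forall>v\<in>pverts G. norm (\<zeta> v :: complex) = 1) \<and>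
          (\<forall>(i, j)\<in>parcs G. \<phi>\<^sub>1 (i, j) = inverse (\<zeta> i) * \<phi>\<^sub>2 (i, j) * \<zeta> j))"

text \<open>
  \<open>cycle_traversal G n c\<close>: the map \<open>c\<close> is an isomorphism from the standard cycle on
  \<open>{0, \<dots>, n - 1}\<close> to \<open>G\<close>; thus \<open>G\<close> is a copy of \<open>C\<^sub>n\<close> iff such a \<open>c\<close> exists, and \<open>c\<close> fixes a
  starting point and a direction.  Changing the starting point leaves \<open>cycle_gain\<close> unchanged
  and reversing the direction inverts it, so the values \<open>1\<close> and \<open>-1\<close> do not depend on \<open>c\<close>.
\<close>

definition cycle_traversal :: "'v pair_pre_digraph \<Rightarrow> nat \<Rightarrow> (nat \<Rightarrow> 'v) \<Rightarrow> bool" where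
  "cycle_traversal G n c \<longleftrightarrow>
     3 \<le> n \<and> bij_betw c {..<n} (pverts G) \<and>
     parcs G = (\<Union>i<n. {(c i, c (Suc i mod n)), (c (Suc i mod n), c i)})"

definition cycle_gain :: "('v \<times> 'v \<Rightarrow> complex) \<Rightarrow> nat \<Rightarrow> (nat \<Rightarrow> 'v) \<Rightarrow> complex" where
  "cycle_gain \<phi> n c = (\<Prod>i<n. \<phi> (c i, c (Suc i mod n)))"

text \<open>
  In the equality case of the rank bound, a gain \<open>\<plusminus>1\<close> on \<open>C\<^sub>n\<close> with \<open>n\<close> even is read as the sign
  \<open>(-1) ^ (n div 2)\<close>, the one for which the adjacency matrix is singular (its rank is then
  \<open>n - 2\<close>).  For the opposite sign the rank is \<open>n\<close>, e.g. for \<open>C\<^sub>6\<close> with all gains \<open>1\<close>.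
\<close>

end

theory Submission
  imports Defs
begin

text \<open>
  The bound rests on a connected dominating set \<open>S\<close> with at most as many vertices as the rank
  \<open>r\<close>.  A maximal connected set of vertices whose rows of the adjacency matrix are linearly
  independent is such a set (\<open>connected_dominating_independent_rows\<close>): a vertex \<open>w\<close> adjacent to \<open>S\<close>
  that has a neighbour \<open>u\<close> not dominated by \<open>S\<close> could be added, because the rows of \<open>S\<close> vanish in
  the column \<open>u\<close>.  Each of the \<open>n - card S\<close> vertices outside \<open>S\<close> has a neighbour in \<open>S\<close>, while the
  vertices of \<open>S\<close> have total degree at most \<open>\<Delta> * card S\<close>, of which a spanning tree of \<open>S\<close> uses
  \<open>2 * (card S - 1)\<close>.  Hence \<open>n - 2 \<le> (\<Delta> - 1) * card S \<le> (\<Delta> - 1) * r\<close> (\<open>edge_count\<close>).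

  If equality holds, then \<open>card S = r\<close>, so every row is a combination of the rows of \<open>S\<close>;
  moreover \<open>S\<close> induces a tree, all its vertices have degree \<open>\<Delta>\<close>, and each vertex \<open>t\<close> outside \<open>S\<close>
  has exactly one neighbour in \<open>S\<close>.  Counting the tree edges around the support of the combination
  that yields the row of \<open>t\<close> (\<open>extremal_outside_vertex\<close>) gives two facts: the graph is regular, and
  for \<open>\<Delta> \<ge> 3\<close> the row of \<open>t\<close> is a multiple of a single row of \<open>S\<close>.  In the latter case the graph
  falls into two classes of vertices with proportional rows, so it is a balanced complete
  bipartite graph with trivial gains up to switching.  For \<open>\<Delta> = 2\<close> a connected regular graph is a
  cycle.

  On a cycle, rank \<open>n - 2\<close> means a left kernel of dimension two.  After the gains have been
  gauged away along the cycle, a kernel vector is a sequence with \<open>y (j + 2) = - y j\<close>, and two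
  independent ones close up exactly if \<open>n\<close> is even and the cycle gain is \<open>(-1) ^ (n div 2)\<close>
  (\<open>singular_imp_cycle_gain\<close>, \<open>cycle_gain_imp_singular\<close>).  For the converse direction of the
  equivalence it is enough to bound the rank of the two families from above, as the general bound
  supplies the other inequality.
\<close>

section \<open>Rows of a matrix\<close>

text \<open>
  Independence is put in terms of coefficients indexed by row numbers, and not as independence
  of the set of row vectors, so that two equal rows count as dependent.
\<close>

definition independent_rows :: "'a::field ^ 'n ^ 'm \<Rightarrow> 'm set \<Rightarrow> bool" where
  "independent_rows A S \<longleftrightarrow>
     (\<forall>z. (\<forall>j. (\<Sum>s\<in>S. z s * A $ s $ j) = 0) \<longrightarrow> (\<forall>s\<in>S. z s = 0))"

text \<open>
  The column \<open>u\<close> is the only information about the new row that is needed: it isolates the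
  coefficient of that row in every dependency.
\<close>

lemma independent_rows_insert:
  fixes A :: "'a::field ^ 'n ^ 'm"
  assumes S: "independent_rows A S"
    and zero: "\<And>s. s \<in> S \<Longrightarrow> A $ s $ u = 0" and nz: "A $ w $ u \<noteq> 0"
  shows "independent_rows A (insert w S)"
  unfolding independent_rows_def
proof (intro allI impI)
  fix z
  assume dep: "\<forall>j. (\<Sum>s\<in>insert w S. z s * A $ s $ j) = 0"
  have fin: "finite S" by simp
  have w: "w \<notin> S" using zero nz by blast
  have split: "(\<Sum>s\<in>insert w S. z s * A $ s $ j) = z w * A $ w $ j + (\<Sum>s\<in>S. z s * A $ s $ j)" for j
    using fin w by simp
  have "(\<Sum>s\<in>S. z s * A $ s $ u) = 0" using zero by simp
  then have zw: "z w = 0" using dep split[of u] nz by simp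
  then have "\<forall>j. (\<Sum>s\<in>S. z s * A $ s $ j) = 0" using dep split by simp
  then show "\<forall>s\<in>insert w S. z s = 0" using S zw unfolding independent_rows_def by blast
qed

lemma independent_rows_imp_independent:
  fixes A :: "'a::field ^ 'n ^ 'm"
  assumes "independent_rows A S"
  shows "inj_on (\<lambda>s. row s A) S" and "vec.independent ((\<lambda>s. row s A) ` S)"
proof -
  show inj: "inj_on (\<lambda>s. row s A) S"
  proof (rule inj_onI, rule ccontr)
    fix s s' assume s: "s \<in> S" "s' \<in> S" "row s A = row s' A" "s \<noteq> s'"
    define z where "z i = (if i = s then 1 else if i = s' then -1 else (0::'a))" for i
    have eq: "A $ s $ j = A $ s' $ j" for j
      using s(3) by (simp add: row_def vec_eq_iff)
    have "(\<Sum>i\<in>S. z i * A $ i $ j) = (\<Sum>i\<in>{s, s'}. z i * A $ i $ j)" for j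
      by (rule sum.mono_neutral_right) (use s in \<open>auto simp: z_def\<close>)
    also have "(\<Sum>i\<in>{s, s'}. z i * A $ i $ j) = 0" for j
      using s(4) eq[of j] by (simp add: z_def)
    finally have "z s = 0" using assms s(1) unfolding independent_rows_def by blast
    then show False by (simp add: z_def)
  qed
  show "vec.independent ((\<lambda>s. row s A) ` S)"
    unfolding vec.independent_explicit
  proof (intro conjI allI impI ballI)
    show "finite ((\<lambda>s. row s A) ` S)" by simp
    fix c v
    assume 0: "(\<Sum>v\<in>(\<lambda>s. row s A) ` S. c v *s v) = 0" and v: "v \<in> (\<lambda>s. row s A) ` S"
    have "(\<Sum>s\<in>S. c (row s A) *s row s A) = 0"
      using 0 by (simp add: sum.reindex[OF inj] o_def)
    then have "(\<Sum>s\<in>S. c (row s A) * A $ s $ j) = 0" for j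
      by (auto simp: vec_eq_iff row_def)
    then have "\<forall>s\<in>S. c (row s A) = 0"
      using assms[unfolded independent_rows_def, THEN spec, of "\<lambda>s. c (row s A)"] by simp
    then show "c v = 0" using v by blast
  qed
qed

lemma independent_rows_card_le_rank:
  fixes A :: "'a::field ^ 'n ^ 'm"
  assumes "independent_rows A S"
  shows "card S \<le> rank A"
proof -
  have "card ((\<lambda>s. row s A) ` S) \<le> vec.dim (rows A)"
    by (rule vec.independent_card_le_dim)
      (use independent_rows_imp_independent[OF assms] in \<open>auto simp: rows_def\<close>)
  then show ?thesis
    using card_image[OF independent_rows_imp_independent(1)[OF assms]]
    by (simp add: row_rank_def_gen)
qed

lemma full_independent_rows_expand:
  fixes A :: "'a::field ^ 'n ^ 'm"
  assumes "independent_rows A S" and "rank A \<le> card S"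
  shows "\<exists>x. \<forall>v. A $ t $ v = (\<Sum>s\<in>S. x s * A $ s $ v)"
proof -
  let ?B = "(\<lambda>s. row s A) ` S"
  note inj = independent_rows_imp_independent(1)[OF assms(1)]
  have "rows A \<subseteq> vec.span ?B"
    by (rule vec.card_ge_dim_independent)
      (use independent_rows_imp_independent[OF assms(1)] assms(2) card_image[OF inj]
        in \<open>auto simp: rows_def row_rank_def_gen\<close>)
  then have "row t A \<in> vec.span ?B" by (auto simp: rows_def)
  then obtain u where "row t A = (\<Sum>v\<in>?B. u v *s v)"
    by (auto simp: vec.span_finite)
  then have "row t A = (\<Sum>s\<in>S. u (row s A) *s row s A)"
    by (simp add: sum.reindex[OF inj] o_def)
  then have "\<forall>v. A $ t $ v = (\<Sum>s\<in>S. u (row s A) * A $ s $ v)"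
    by (simp add: vec_eq_iff row_def)
  then show ?thesis by (rule exI[where x = "\<lambda>s. u (row s A)"])
qed

text \<open>
  A left kernel of dimension at least two contains a nonzero vector with a prescribed zero: even
  without the row \<open>w\<close> there are more rows than the rank.
\<close>

lemma row_dependency_vanishing_at:
  fixes A :: "'a::field ^ 'n ^ 'm"
  assumes "rank A + 1 < CARD('m)"
  obtains z where "z w = 0" "z \<noteq> (\<lambda>_. 0)" "\<And>j. (\<Sum>i\<in>UNIV. z i * A $ i $ j) = 0"
proof -
  have "\<not> independent_rows A (UNIV - {w})"
    using independent_rows_card_le_rank[of A "UNIV - {w}"] assms
    by (auto simp: card_Diff_singleton)
  then obtain z where z: "\<And>j. (\<Sum>s\<in>UNIV - {w}. z s * A $ s $ j) = 0" and nz: "\<exists>s. s \<noteq> w \<and> z s \<noteq> 0"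
    unfolding independent_rows_def by blast
  have "(\<Sum>i\<in>UNIV. (z(w := 0)) i * A $ i $ j) = 0" for j
  proof -
    have "(\<Sum>i\<in>UNIV. (z(w := 0)) i * A $ i $ j) = (\<Sum>s\<in>UNIV - {w}. (z(w := 0)) s * A $ s $ j)"
      by (rule sum.mono_neutral_right) auto
    also have "\<dots> = (\<Sum>s\<in>UNIV - {w}. z s * A $ s $ j)" by (rule sum.cong) auto
    finally show ?thesis using z by simp
  qed
  then show thesis using nz by (intro that[of "z(w := 0)"]) (auto simp: fun_eq_iff)
qed

lemma rank_le_card_span:
  fixes A :: "'a::field ^ 'n ^ 'm"
  assumes "\<And>i. row i A \<in> vec.span W" and "finite W"
  shows "rank A \<le> card W"
  unfolding row_rank_def_gen
  by (rule vec.dim_le_card) (use assms in \<open>auto simp: rows_def\<close>)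

section \<open>Neighbourhoods and connectivity\<close>

context gain_graph
begin

abbreviation A :: "complex ^ 'v ^ 'v" where "A \<equiv> adjacency_matrix G \<phi>"

definition nbrs :: "'v \<Rightarrow> 'v set" where "nbrs v = {w. (v, w) \<in> parcs G}"

lemma nbrs_sym: "w \<in> nbrs v \<longleftrightarrow> v \<in> nbrs w"
  using arcs_symmetric[of v w] arcs_symmetric[of w v] by (auto simp: nbrs_def)

lemma not_self_nbr: "v \<notin> nbrs v"
  using pair_no_loops[of "(v, v)"] by (auto simp: nbrs_def)

lemma A_nth: "A $ s $ v = (if v \<in> nbrs s then \<phi> (s, v) else 0)"
  by (simp add: adjacency_matrix_def nbrs_def)

lemma gain_norm: "v \<in> nbrs s \<Longrightarrow> norm (\<phi> (s, v)) = 1"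
  using gain_unit by (simp add: nbrs_def)

lemma gain_nonzero: "v \<in> nbrs s \<Longrightarrow> \<phi> (s, v) \<noteq> 0"
  using gain_norm by fastforce

lemma gain_inv: "v \<in> nbrs s \<Longrightarrow> \<phi> (v, s) = inverse (\<phi> (s, v))"
  using gain_inverse[of v s] nbrs_sym[of v s] unfolding nbrs_def by blast

lemma A_nth_eq_0_iff: "A $ s $ v = 0 \<longleftrightarrow> v \<notin> nbrs s"
  using gain_nonzero by (auto simp: A_nth)

lemma out_degree_eq: "out_degree (with_proj G) v = card (nbrs v)"
proof -
  have "out_arcs (with_proj G) v = Pair v ` nbrs v"
    by (auto simp: out_arcs_def nbrs_def)
  then show ?thesis by (simp add: out_degree_def card_image inj_on_def)
qed

lemma max_degree_eq: "max_degree G = Max (range (\<lambda>v. card (nbrs v)))"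
  unfolding max_degree_def verts_UNIV by (simp add: out_degree_eq)

lemma card_nbrs_le_max_degree: "card (nbrs v) \<le> max_degree G"
  unfolding max_degree_eq by (rule Max_ge) auto

lemma max_degree_attained: obtains v where "card (nbrs v) = max_degree G"
proof -
  have "max_degree G \<in> range (\<lambda>v. card (nbrs v))"
    unfolding max_degree_eq by (rule Max_in) auto
  then show thesis using that by auto
qed

lemma max_degree_regular: "(\<And>v. card (nbrs v) = d) \<Longrightarrow> max_degree G = d"
  using max_degree_attained by metis

text \<open>
  Connectivity enters the proof only in this form.
\<close>

lemma connected_closed_imp_UNIV:
  assumes conn: "Digraph_Component.connected (with_proj G)"
    and v: "v \<in> C" and closed: "\<And>w. w \<in> C \<Longrightarrow> nbrs w \<subseteq> C"
  shows "C = UNIV"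
proof -
  have "u \<in> C" for u
  proof -
    have "(v, u) \<in> rtrancl_on UNIV (parcs (mk_symmetric (with_proj G)))"
      using conn by (auto simp: connected_def strongly_connected_def reachable_def verts_UNIV)
    then show "u \<in> C"
    proof (induction rule: rtrancl_on_induct)
      case base
      show ?case by (rule v)
    next
      case (step x y)
      then have "y \<in> nbrs x"
        using nbrs_sym by (auto simp: mk_symmetric_def nbrs_def)
      then show ?case using step closed by blast
    qed
  qed
  then show ?thesis by blast
qed

section \<open>Spanning trees\<close>

text \<open>
  Each vertex other than the root points to a parent in \<open>S\<close>.  The height only has to decrease
  towards the root; it excludes cycles and makes every edge of the tree have a unique lower end,
  its parent, so that edges can be counted by charging them to their children.
\<close>

definition spanning_tree :: "'v set \<Rightarrow> 'v \<Rightarrow> ('v \<Rightarrow> 'v) \<Rightarrow> ('v \<Rightarrow> nat) \<Rightarrow> bool" where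
  "spanning_tree S \<rho> p h \<longleftrightarrow>
     \<rho> \<in> S \<and> (\<forall>v\<in>S - {\<rho>}. p v \<in> S \<and> p v \<in> nbrs v \<and> h (p v) < h v)"

lemma spanning_tree_insert:
  assumes T: "spanning_tree S \<rho> p h" and w: "w \<notin> S" "s \<in> S" "s \<in> nbrs w"
  shows "spanning_tree (insert w S) \<rho> (p(w := s)) (h(w := Suc (h s)))"
  using T w unfolding spanning_tree_def by auto

text \<open>
  The parent edges of a spanning tree of \<open>S\<close>, taken in both orientations, are
  \<open>2 * (card S - 1)\<close> different arcs inside \<open>S\<close>.  If there are no further arcs inside \<open>S\<close>, then
  the subgraph induced by \<open>S\<close> is that tree.
\<close>

lemma spanning_tree_edges:
  assumes T: "spanning_tree S \<rho> p h"
  shows "2 * (card S - 1) \<le> (\<Sum>s\<in>S. card (nbrs s \<inter> S))"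
    and "\<lbrakk>(\<Sum>s\<in>S. card (nbrs s \<inter> S)) = 2 * (card S - 1); s \<in> S; v \<in> nbrs s \<inter> S\<rbrakk>
      \<Longrightarrow> s \<noteq> \<rho> \<and> v = p s \<or> v \<noteq> \<rho> \<and> s = p v"
proof -
  let ?E = "Sigma S (\<lambda>s. nbrs s \<inter> S)"
  let ?up = "(\<lambda>v. (v, p v)) ` (S - {\<rho>})" and ?down = "(\<lambda>v. (p v, v)) ` (S - {\<rho>})"
  have E: "card ?E = (\<Sum>s\<in>S. card (nbrs s \<inter> S))" by simp
  have sub: "?up \<union> ?down \<subseteq> ?E"
    using T nbrs_sym unfolding spanning_tree_def by auto
  have "p (p v) \<noteq> v" if "v \<in> S - {\<rho>}" "p v \<in> S - {\<rho>}" for v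
    using T that unfolding spanning_tree_def by (metis less_asym)
  then have disj: "?up \<inter> ?down = {}" by auto
  have \<rho>: "\<rho> \<in> S" using T by (simp add: spanning_tree_def)
  have "card ?up = card S - 1" "card ?down = card S - 1"
    using \<rho> by (simp_all add: card_image inj_on_def)
  then have card: "card (?up \<union> ?down) = 2 * (card S - 1)"
    using disj by (simp add: card_Un_disjoint)
  show "2 * (card S - 1) \<le> (\<Sum>s\<in>S. card (nbrs s \<inter> S))"
    using card_mono[OF _ sub] card E by simp
  assume "(\<Sum>s\<in>S. card (nbrs s \<inter> S)) = 2 * (card S - 1)" and sv: "s \<in> S" "v \<in> nbrs s \<inter> S"
  then have "?up \<union> ?down = ?E"
    using card_subset_eq[OF _ sub] card E by simp
  moreover have "(s, v) \<in> ?E" using sv by blast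
  ultimately show "s \<noteq> \<rho> \<and> v = p s \<or> v \<noteq> \<rho> \<and> s = p v" by blast
qed

text \<open>
  The forest bound for the bipartite graph of the tree edges between \<open>X\<close> and \<open>Y\<close>; where the two
  sets overlap, this takes place in the bipartite double cover of the tree, which is a forest too.
  Charge each pair to its child, an element of the disjoint sum of \<open>X\<close> and \<open>Y\<close>.  An element of
  \<open>X \<union> Y\<close> of least height is charged nothing on the side where it was found, since its parent
  would be lower still; this saves one.
\<close>

lemma induced_tree_cross_edges:
  assumes T: "spanning_tree S \<rho> p h"
    and edges: "(\<Sum>s\<in>S. card (nbrs s \<inter> S)) = 2 * (card S - 1)"
    and XY: "X \<subseteq> S" "Y \<subseteq> S" "X \<union> Y \<noteq> {}"
  shows "(\<Sum>s\<in>X. card (nbrs s \<inter> Y)) + 1 \<le> card X + card Y"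
proof -
  let ?E = "Sigma X (\<lambda>s. nbrs s \<inter> Y)"
  let ?up = "\<lambda>X. (\<lambda>s. (s, p s)) ` X" and ?down = "\<lambda>Y. (\<lambda>v. (p v, v)) ` Y"
  have tree: "s \<noteq> \<rho> \<and> v = p s \<or> v \<noteq> \<rho> \<and> s = p v" if "(s, v) \<in> ?E" for s v
    using spanning_tree_edges(2)[OF T edges, of s v] that XY by auto
  have lower: "h (p v) < h v" if "v \<in> S" "v \<noteq> \<rho>" for v
    using T that by (auto simp: spanning_tree_def)
  obtain z where z: "z \<in> X \<union> Y" "\<And>y. y \<in> X \<union> Y \<Longrightarrow> h z \<le> h y"
    using XY(3) ex_has_least_nat[of "\<lambda>z. z \<in> X \<union> Y" _ h] by blast
  have "card ?E + 1 \<le> card X + card Y"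
  proof (cases "z \<in> X")
    case True
    have "?E \<subseteq> ?up (X - {z}) \<union> ?down Y"
    proof
      fix e assume e: "e \<in> ?E"
      then obtain s v where sv: "e = (s, v)" "s \<in> X" "v \<in> Y" by blast
      have "s \<noteq> z" if "s \<noteq> \<rho>" "v = p s"
        using z(2)[of v] lower[of s] that sv XY by fastforce
      then show "e \<in> ?up (X - {z}) \<union> ?down Y"
        using tree[of s v] e sv by blast
    qed
    then have "card ?E \<le> card (?up (X - {z}) \<union> ?down Y)" by (intro card_mono) auto
    also have "\<dots> \<le> card (X - {z}) + card Y"
      by (rule order_trans[OF card_Un_le]) (intro add_mono card_image_le; simp)
    finally show ?thesis using True card_Suc_Diff1[of X z] by simp
  next
    case False
    then have zY: "z \<in> Y" using z by blast
    have "?E \<subseteq> ?up X \<union> ?down (Y - {z})"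
    proof
      fix e assume e: "e \<in> ?E"
      then obtain s v where sv: "e = (s, v)" "s \<in> X" "v \<in> Y" by blast
      have "v \<noteq> z" if "v \<noteq> \<rho>" "s = p v"
        using z(2)[of s] lower[of v] that sv XY by fastforce
      then show "e \<in> ?up X \<union> ?down (Y - {z})"
        using tree[of s v] e sv by blast
    qed
    then have "card ?E \<le> card (?up X \<union> ?down (Y - {z}))" by (intro card_mono) auto
    also have "\<dots> \<le> card X + card (Y - {z})"
      by (rule order_trans[OF card_Un_le]) (intro add_mono card_image_le; simp)
    finally show ?thesis using zY card_Suc_Diff1[of Y z] by simp
  qed
  then show ?thesis by simp
qed

section \<open>A connected dominating set of independent rows\<close>

text \<open>
  Take a largest set \<open>S\<close> that is connected and has independent rows.  If it were not dominating,
  then by connectivity some \<open>w\<close> adjacent to \<open>S\<close> would have a neighbour \<open>u\<close> at distance two from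
  \<open>S\<close>.  In the column \<open>u\<close> the rows of \<open>S\<close> vanish and the row of \<open>w\<close> does not, so \<open>w\<close> could be
  added to \<open>S\<close>.  The argument shows that the connected domination number is at most the rank.
\<close>

lemma connected_dominating_independent_rows:
  assumes conn: "Digraph_Component.connected (with_proj G)" and deg: "max_degree G \<ge> 1"
  obtains S \<rho> p h where "spanning_tree S \<rho> p h" "independent_rows A S"
    "\<And>t. t \<notin> S \<Longrightarrow> nbrs t \<inter> S \<noteq> {}"
proof -
  define good where
    "good S \<longleftrightarrow> independent_rows A S \<and> (\<exists>\<rho> p h. spanning_tree S \<rho> p h)" for S
  obtain v where "card (nbrs v) = max_degree G" by (rule max_degree_attained)
  then have "nbrs v \<noteq> {}" using deg by auto
  then obtain u where u: "u \<in> nbrs v" by blast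
  have "independent_rows A {}" by (simp add: independent_rows_def)
  then have "independent_rows A {v}"
    by (rule independent_rows_insert[where u = u]) (use u in \<open>simp_all add: A_nth_eq_0_iff\<close>)
  then have "good {v}" by (auto simp: good_def spanning_tree_def)
  then obtain S where S: "good S" and max: "\<And>S'. good S' \<Longrightarrow> card S' \<le> card S"
    using ex_has_greatest_nat[of good "{v}" card "Suc (card (UNIV :: 'v set))"]
      card_mono[of "UNIV :: 'v set"] by (metis finite le_imp_less_Suc less_imp_le top_greatest)
  obtain \<rho> p h where T: "spanning_tree S \<rho> p h" using S by (auto simp: good_def)
  have "nbrs t \<inter> S \<noteq> {}" if t: "t \<notin> S" for t
  proof (rule ccontr)
    assume "\<not> nbrs t \<inter> S \<noteq> {}"
    then have t': "t \<notin> S \<union> (\<Union>s\<in>S. nbrs s)" using t nbrs_sym by blast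
    have "\<rho> \<in> S" using T by (simp add: spanning_tree_def)
    then obtain w u where w: "w \<in> S \<union> (\<Union>s\<in>S. nbrs s)" and u: "u \<in> nbrs w"
      "u \<notin> S \<union> (\<Union>s\<in>S. nbrs s)"
      using connected_closed_imp_UNIV[OF conn, of \<rho> "S \<union> (\<Union>s\<in>S. nbrs s)"] t' by blast
    from w u obtain s where s: "s \<in> S" "s \<in> nbrs w" and wS: "w \<notin> S"
      using nbrs_sym by blast
    have "independent_rows A (insert w S)"
      using S unfolding good_def
      by (intro independent_rows_insert[where u = u]) (use u in \<open>auto simp: A_nth_eq_0_iff\<close>)
    then have "good (insert w S)"
      using spanning_tree_insert[OF T wS s] unfolding good_def by blast
    from max[OF this] wS show False by simp
  qed
  then show thesis using that T S unfolding good_def by blast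
qed

section \<open>Counting edges\<close>

text \<open>
  Double counting of the edges between \<open>S\<close> and its complement.  There are at least as many as
  vertices outside \<open>S\<close>, by domination, and at most \<open>card S * max_degree G - 2 * (card S - 1)\<close>, since
  the spanning tree uses up \<open>2 * (card S - 1)\<close> of the degrees.  If both bounds are attained then so
  is each estimate that went into them.
\<close>

lemma edge_count:
  assumes T: "spanning_tree S \<rho> p h" and dom: "\<And>t. t \<notin> S \<Longrightarrow> nbrs t \<inter> S \<noteq> {}"
  shows "CARD('v) + card S \<le> card S * max_degree G + 2"
    and "CARD('v) + card S = card S * max_degree G + 2 \<Longrightarrow>
      (\<forall>s\<in>S. card (nbrs s) = max_degree G) \<and> (\<forall>t. t \<notin> S \<longrightarrow> card (nbrs t \<inter> S) = 1) \<and>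
      (\<Sum>s\<in>S. card (nbrs s \<inter> S)) = 2 * (card S - 1)"
proof -
  let ?inner = "\<Sum>s\<in>S. card (nbrs s \<inter> S)"
  have S: "card S \<ge> 1" using T by (auto simp: spanning_tree_def Suc_le_eq card_gt_0_iff)
  have compl: "card (- S) + card S = CARD('v)"
    using card_Un_disjoint[of "- S" S] by (simp add: Compl_partition2)
  have "card (Sigma (- S) (\<lambda>t. nbrs t \<inter> S)) = card (Sigma S (\<lambda>s. nbrs s - S))"
    by (rule bij_betw_same_card[of prod.swap])
      (use nbrs_sym in \<open>auto simp: bij_betw_def inj_on_def image_iff\<close>)
  then have cross: "(\<Sum>t\<in>- S. card (nbrs t \<inter> S)) = (\<Sum>s\<in>S. card (nbrs s - S))" by simp
  have "card (nbrs s) = card (nbrs s \<inter> S) + card (nbrs s - S)" for s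
    by (metis card_Int_Diff finite)
  then have degs: "(\<Sum>s\<in>S. card (nbrs s)) = ?inner + (\<Sum>s\<in>S. card (nbrs s - S))"
    by (simp add: sum.distrib)
  have ge1: "1 \<le> card (nbrs t \<inter> S)" if "t \<in> - S" for t
    using dom[of t] that by (auto simp: Suc_le_eq card_gt_0_iff)
  then have le1: "card (- S) \<le> (\<Sum>t\<in>- S. card (nbrs t \<inter> S))"
    using sum_mono[of "- S" "\<lambda>_. 1" "\<lambda>t. card (nbrs t \<inter> S)"] by simp
  have le2: "(\<Sum>s\<in>S. card (nbrs s)) \<le> card S * max_degree G"
    using sum_mono[of S "\<lambda>s. card (nbrs s)" "\<lambda>_. max_degree G"] card_nbrs_le_max_degree by simp
  note le3 = spanning_tree_edges(1)[OF T]
  show "CARD('v) + card S \<le> card S * max_degree G + 2"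
    using compl cross degs le1 le2 le3 S by linarith
  assume eq: "CARD('v) + card S = card S * max_degree G + 2"
  have "card (- S) = (\<Sum>t\<in>- S. card (nbrs t \<inter> S))"
    using compl cross degs le1 le2 le3 S eq by linarith
  then have e1: "(\<Sum>t\<in>- S. 1) = (\<Sum>t\<in>- S. card (nbrs t \<inter> S))" by simp
  have "(\<Sum>s\<in>S. card (nbrs s)) = card S * max_degree G"
    using compl cross degs le1 le2 le3 S eq by linarith
  then have e2: "(\<Sum>s\<in>S. card (nbrs s)) = (\<Sum>s\<in>S. max_degree G)" by simp
  have e3: "?inner = 2 * (card S - 1)"
    using compl cross degs le1 le2 le3 S eq by linarith
  have "card (nbrs t \<inter> S) = 1" if "t \<notin> S" for t
    using sum_mono_inv[OF e1 ge1, of t] that by simp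
  moreover have "card (nbrs s) = max_degree G" if "s \<in> S" for s
    using sum_mono_inv[OF e2 card_nbrs_le_max_degree that] by simp
  ultimately show "(\<forall>s\<in>S. card (nbrs s) = max_degree G) \<and>
      (\<forall>t. t \<notin> S \<longrightarrow> card (nbrs t \<inter> S) = 1) \<and> ?inner = 2 * (card S - 1)"
    using e3 by blast
qed

lemma card_verts_le_rank_mult:
  assumes "Digraph_Component.connected (with_proj G)" and "max_degree G \<ge> 1"
  shows "CARD('v) \<le> rank A * (max_degree G - 1) + 2"
proof -
  obtain S \<rho> p h where S: "spanning_tree S \<rho> p h" "independent_rows A S"
    "\<And>t. t \<notin> S \<Longrightarrow> nbrs t \<inter> S \<noteq> {}"
    using connected_dominating_independent_rows[OF assms] by blast
  have "card S * max_degree G = card S * (max_degree G - 1) + card S"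
    using assms(2) by (cases "max_degree G") auto
  then have "CARD('v) \<le> card S * (max_degree G - 1) + 2" using edge_count(1)[OF S(1,3)] by simp
  also have "\<dots> \<le> rank A * (max_degree G - 1) + 2"
    using independent_rows_card_le_rank[OF S(2)] by simp
  finally show ?thesis .
qed

section \<open>Extremal graphs\<close>

text \<open>
  In the case of equality the set \<open>S\<close> has as many elements as the rank, hence its rows span all
  rows, and the edge count is tight.
\<close>

lemma extremal_set:
  assumes conn: "Digraph_Component.connected (with_proj G)" and deg: "max_degree G \<ge> 2"
    and extremal: "CARD('v) = rank A * (max_degree G - 1) + 2"
  obtains S \<rho> p h where "spanning_tree S \<rho> p h" "S \<noteq> UNIV"
    "(\<Sum>s\<in>S. card (nbrs s \<inter> S)) = 2 * (card S - 1)"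
    "\<forall>s\<in>S. card (nbrs s) = max_degree G"
    "\<forall>t. t \<notin> S \<longrightarrow> (\<exists>l. nbrs t \<inter> S = {l})"
    "\<forall>t. \<exists>x. \<forall>v. A $ t $ v = (\<Sum>s\<in>S. x s * A $ s $ v)"
proof -
  have "max_degree G \<ge> 1" using deg by simp
  then obtain S \<rho> p h where S: "spanning_tree S \<rho> p h" "independent_rows A S"
    "\<And>t. t \<notin> S \<Longrightarrow> nbrs t \<inter> S \<noteq> {}"
    using connected_dominating_independent_rows[OF conn] by blast
  obtain d where d: "max_degree G = Suc (Suc d)"
    using deg by (metis add_2_eq_Suc le_Suc_ex)
  have le: "card S \<le> rank A" by (rule independent_rows_card_le_rank[OF S(2)])
  have "CARD('v) \<le> card S * Suc d + 2" using edge_count(1)[OF S(1,3)] d by simp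
  then have "rank A * Suc d \<le> card S * Suc d" using extremal d by simp
  then have "rank A \<le> card S" by (simp only: mult_le_cancel2)
  then have eq: "card S = rank A" using le by simp
  have "CARD('v) + card S = card S * max_degree G + 2" using extremal d eq by simp
  note count = edge_count(2)[OF S(1,3) this]
  show thesis
  proof (rule that[OF S(1)])
    have "card S < CARD('v)" using extremal d eq by simp
    then show "S \<noteq> UNIV" by auto
    show "(\<Sum>s\<in>S. card (nbrs s \<inter> S)) = 2 * (card S - 1)"
      and "\<forall>s\<in>S. card (nbrs s) = max_degree G" using count by blast+
    show "\<forall>t. t \<notin> S \<longrightarrow> (\<exists>l. nbrs t \<inter> S = {l})"
      using count by (metis card_1_singletonE)
    show "\<forall>t. \<exists>x. \<forall>v. A $ t $ v = (\<Sum>s\<in>S. x s * A $ s $ v)"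
      using full_independent_rows_expand[OF S(2)] eq by simp
  qed
qed

text \<open>
  This is the heart of the equality case.  Let \<open>X\<close> be the support of the expansion of the row of
  \<open>t\<close> in the rows of \<open>S\<close>, and \<open>Y\<close> the set of neighbours of \<open>X\<close> in \<open>S\<close>.  A vertex \<open>v\<close> of \<open>S\<close>
  other than \<open>l\<close> is not adjacent to \<open>t\<close>, so the terms of the expansion cancel in its column;
  hence \<open>v\<close> has no neighbour in \<open>X\<close> or at least two.  Therefore the number \<open>e\<close> of adjacent pairs
  between \<open>X\<close> and \<open>Y\<close> is at least \<open>2 * card Y - 1\<close>, while it is at most
  \<open>card X + card Y - 1\<close> inside a tree; together \<open>e + 1 \<le> 2 * card X\<close>.

  On the other hand a vertex outside \<open>S\<close> sees a single vertex of \<open>S\<close>, so in its column the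
  expansion has at most one nonzero term, and it is adjacent to \<open>t\<close> exactly if it is adjacent to
  \<open>X\<close>.  As the vertices of \<open>S\<close> have degree \<open>d\<close>, this gives \<open>card (nbrs t) = 1 + d * card X - e\<close>
  and so \<open>(d - 2) * card X + 2 \<le> card (nbrs t) \<le> d\<close>.  As \<open>X\<close> is not empty, \<open>t\<close> has degree \<open>d\<close>,
  and for \<open>d > 2\<close> the support \<open>X\<close> is a single vertex.
\<close>

lemma extremal_outside_vertex:
  assumes T: "spanning_tree S \<rho> p h"
    and edges: "(\<Sum>s\<in>S. card (nbrs s \<inter> S)) = 2 * (card S - 1)"
    and reg: "\<And>s. s \<in> S \<Longrightarrow> card (nbrs s) = d" and d: "d \<ge> 2"
    and uniq: "\<And>t. t \<notin> S \<Longrightarrow> \<exists>l. nbrs t \<inter> S = {l}"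
    and row: "\<And>v. A $ t $ v = (\<Sum>s\<in>S. x s * A $ s $ v)"
    and t: "t \<notin> S" "nbrs t \<inter> S = {l}" and le: "card (nbrs t) \<le> d"
  shows "card (nbrs t) = d"
    and "d \<noteq> 2 \<Longrightarrow> \<exists>m\<in>S. nbrs m \<inter> S = {l} \<and> (\<exists>a. a \<noteq> 0 \<and> (\<forall>v. A $ t $ v = a * A $ m $ v))"
proof -
  define X where "X = {s \<in> S. x s \<noteq> 0}"
  define Y where "Y = S \<inter> (\<Union>s\<in>X. nbrs s)"
  have XS: "X \<subseteq> S" and YS: "Y \<subseteq> S" by (auto simp: X_def Y_def)
  have rowX: "A $ t $ v = (\<Sum>s\<in>nbrs v \<inter> X. x s * A $ s $ v)" for v
    unfolding row[of v]
    by (rule sum.mono_neutral_right)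
      (use nbrs_sym in \<open>auto simp: X_def A_nth_eq_0_iff\<close>)
  have lS: "l \<in> S" "l \<in> nbrs t" using t(2) by blast+
  then have "nbrs l \<inter> X \<noteq> {}"
    using rowX[of l] A_nth_eq_0_iff[of t l] by force
  then have lY: "l \<in> Y" and X: "X \<noteq> {}"
    using lS nbrs_sym by (auto simp: Y_def)
  have inner: "nbrs s \<inter> S = nbrs s \<inter> Y" if "s \<in> X" for s
    using that by (auto simp: Y_def)

  \<comment> \<open>A single neighbour in \<open>X\<close> would leave one nonzero term in a sum that vanishes.\<close>
  have two: "2 \<le> card (nbrs v \<inter> X)" if v: "v \<in> Y - {l}" for v
  proof -
    have v0: "A $ t $ v = 0"
      using v t(2) by (auto simp: A_nth_eq_0_iff Y_def)
    obtain s where s: "s \<in> nbrs v \<inter> X" using v nbrs_sym by (auto simp: Y_def)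
    have "nbrs v \<inter> X \<noteq> {s}"
    proof
      assume "nbrs v \<inter> X = {s}"
      then have "x s * A $ s $ v = 0" using rowX[of v] v0 by simp
      then show False using s nbrs_sym by (auto simp: X_def A_nth_eq_0_iff)
    qed
    then have "{s} \<subset> nbrs v \<inter> X" using s by blast
    from psubset_card_mono[OF _ this] show ?thesis by simp
  qed
  \<comment> \<open>The vertex \<open>l\<close>, where the sum does not vanish, may have only one neighbour in \<open>X\<close>.\<close>
  have one: "1 \<le> card (nbrs l \<inter> X)"
    using \<open>nbrs l \<inter> X \<noteq> {}\<close> by (simp add: Suc_le_eq card_gt_0_iff)
  let ?e = "\<Sum>s\<in>X. card (nbrs s \<inter> Y)"
  have "card (Sigma X (\<lambda>s. nbrs s \<inter> Y)) = card (Sigma Y (\<lambda>v. nbrs v \<inter> X))"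
    by (rule bij_betw_same_card[of prod.swap])
      (use nbrs_sym in \<open>auto simp: bij_betw_def inj_on_def image_iff\<close>)
  then have "?e = (\<Sum>v\<in>Y. card (nbrs v \<inter> X))" by simp
  also have "\<dots> = card (nbrs l \<inter> X) + (\<Sum>v\<in>Y - {l}. card (nbrs v \<inter> X))"
    using lY by (simp add: sum.remove)
  finally have "?e \<ge> 1 + 2 * card (Y - {l})"
    using one sum_mono[of "Y - {l}" "\<lambda>_. 2" "\<lambda>v. card (nbrs v \<inter> X)"] two by simp
  then have e_lower: "?e + 1 \<ge> 2 * card Y"
    using lY card_Suc_Diff1[of Y l] by simp
  have e_upper: "?e + 1 \<le> card X + card Y"
    by (rule induced_tree_cross_edges[OF T edges XS YS]) (use X in blast)

  have outer: "nbrs t - S = (\<Union>s\<in>X. nbrs s - S)"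
  proof (intro subset_antisym subsetI)
    fix v assume v: "v \<in> nbrs t - S"
    then have "nbrs v \<inter> X \<noteq> {}"
      using rowX[of v] A_nth_eq_0_iff[of t v] by force
    then show "v \<in> (\<Union>s\<in>X. nbrs s - S)" using v nbrs_sym by blast
  next
    fix v assume "v \<in> (\<Union>s\<in>X. nbrs s - S)"
    then obtain s where s: "s \<in> X" "v \<in> nbrs s" "v \<notin> S" by blast
    then have sv: "s \<in> nbrs v" "s \<in> S" using nbrs_sym XS by blast+
    then have "nbrs v \<inter> S = {s}" using uniq[OF s(3)] by (metis IntI singletonD)
    then have "nbrs v \<inter> X = {s}" using XS s(1) sv by blast
    then have "A $ t $ v = x s * A $ s $ v" using rowX[of v] by simp
    then show "v \<in> nbrs t - S"
      using s A_nth_eq_0_iff[of t v] A_nth_eq_0_iff[of s v] by (auto simp: X_def)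
  qed
  have "card (nbrs t - S) = (\<Sum>s\<in>X. card (nbrs s - S))"
    unfolding outer
  proof (rule card_UN_disjoint)
    show "\<forall>i\<in>X. \<forall>j\<in>X. i \<noteq> j \<longrightarrow> (nbrs i - S) \<inter> (nbrs j - S) = {}"
    proof (intro ballI impI)
      fix i j assume ij: "i \<in> X" "j \<in> X" "i \<noteq> j"
      have "i = j" if v: "v \<in> nbrs i" "v \<in> nbrs j" "v \<notin> S" for v
      proof -
        have "i \<in> nbrs v \<inter> S" "j \<in> nbrs v \<inter> S" using v ij XS nbrs_sym by blast+
        then show ?thesis using uniq[OF v(3)] by (metis singletonD)
      qed
      then show "(nbrs i - S) \<inter> (nbrs j - S) = {}" using ij by blast
    qed
  qed auto
  moreover have "card (nbrs s - S) + card (nbrs s \<inter> Y) = d" if "s \<in> X" for s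
    using card_Int_Diff[of "nbrs s" S] inner[OF that] reg[of s] that XS by force
  then have "(\<Sum>s\<in>X. card (nbrs s - S)) + ?e = card X * d"
    by (simp flip: sum.distrib)
  moreover have "card (nbrs t) = card (nbrs t - S) + 1"
    using card_Int_Diff[of "nbrs t" S] t(2) by simp
  ultimately have deg: "card (nbrs t) + ?e = card X * d + 1" by simp

  have X1: "card X \<ge> 1" using X by (simp add: Suc_le_eq card_gt_0_iff)
  obtain k where k: "d = k + 2" using d le_Suc_ex by (metis add.commute)
  have key: "card X * k + 2 \<le> card (nbrs t)"
    using deg e_lower e_upper unfolding k by (simp add: algebra_simps)
  have "1 * k \<le> card X * k" using X1 by (rule mult_le_mono1)
  then show "card (nbrs t) = d" using key le k by linarith
  assume "d \<noteq> 2"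
  then have "k > 0" using k by simp
  moreover have "card X * k \<le> 1 * k" using key le k by linarith
  ultimately have "card X = 1" using X1 by simp
  then obtain m where m: "X = {m}" by (auto simp: card_1_singleton_iff)
  have "card Y \<le> 1" using e_lower e_upper \<open>card X = 1\<close> by simp
  then have "Y = {l}" using lY card_le_Suc0_iff_eq[of Y] by auto
  then have "nbrs m \<inter> S = {l}"
    using inner[of m] m lY by (auto simp: Y_def)
  moreover have "A $ t $ v = x m * A $ m $ v" for v
  proof -
    have "A $ t $ v = (\<Sum>s\<in>X. x s * A $ s $ v)"
      unfolding row[of v] by (rule sum.mono_neutral_right) (auto simp: X_def)
    then show ?thesis using m by simp
  qed
  moreover have "m \<in> S" "x m \<noteq> 0" using m by (auto simp: X_def)
  ultimately show "\<exists>m\<in>S. nbrs m \<inter> S = {l} \<and> (\<exists>a. a \<noteq> 0 \<and> (\<forall>v. A $ t $ v = a * A $ m $ v))"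
    by blast
qed

lemma proportional_rows_imp_nbrs_eq:
  assumes "a \<noteq> 0" and "\<forall>v. A $ t $ v = a * A $ m $ v"
  shows "nbrs t = nbrs m"
  using assms A_nth_eq_0_iff by (metis mult_eq_0_iff subsetI subset_antisym)

lemma extremal_imp_regular:
  assumes conn: "Digraph_Component.connected (with_proj G)" and deg: "max_degree G \<ge> 2"
    and extremal: "CARD('v) = rank A * (max_degree G - 1) + 2"
  shows "card (nbrs v) = max_degree G"
proof -
  obtain S \<rho> p h where S: "spanning_tree S \<rho> p h" "S \<noteq> UNIV"
    "(\<Sum>s\<in>S. card (nbrs s \<inter> S)) = 2 * (card S - 1)"
    "\<forall>s\<in>S. card (nbrs s) = max_degree G"
    "\<forall>t. t \<notin> S \<longrightarrow> (\<exists>l. nbrs t \<inter> S = {l})"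
    "\<forall>t. \<exists>x. \<forall>v. A $ t $ v = (\<Sum>s\<in>S. x s * A $ s $ v)"
    by (rule extremal_set[OF assms])
  note S = S(1-3) S(4)[rule_format] S(5)[rule_format] S(6)[THEN spec]
  show ?thesis
  proof (cases "v \<in> S")
    case True
    then show ?thesis by (rule S(4))
  next
    case False
    obtain l where "nbrs v \<inter> S = {l}" using S(5)[OF False] by blast
    moreover obtain x where "\<forall>w. A $ v $ w = (\<Sum>s\<in>S. x s * A $ s $ w)" using S(6) by blast
    ultimately show ?thesis
      using extremal_outside_vertex(1)[OF S(1,3,4) deg S(5) _ False _ card_nbrs_le_max_degree] by blast
  qed
qed

text \<open>
  For maximal degree at least three the row of a vertex \<open>t\<close> outside \<open>S\<close> is a multiple of the row of
  some \<open>m\<close> in \<open>S\<close>, a leaf of the tree attached to the neighbour \<open>l\<close> of \<open>t\<close> in \<open>S\<close>.  Applied to a further neighbour \<open>t'\<close> of \<open>m\<close> this shows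
  that \<open>l\<close> is in turn a leaf attached to \<open>m\<close>.  Then all neighbours of \<open>l\<close> have the same neighbours
  as \<open>m\<close> and vice versa, so these two sets are closed under adjacency and exhaust the graph.
\<close>

lemma extremal_imp_balanced_bipartite:
  assumes conn: "Digraph_Component.connected (with_proj G)" and deg: "max_degree G \<ge> 3"
    and extremal: "CARD('v) = rank A * (max_degree G - 1) + 2"
  obtains l m U V where "l \<in> V" "m \<in> U" "U \<inter> V = {}" "U \<union> V = UNIV"
    "card U = max_degree G" "card V = max_degree G"
    "\<forall>u\<in>U. nbrs u = V" "\<forall>v\<in>V. nbrs v = U"
    "\<forall>u\<in>U. \<exists>a. \<forall>v. A $ u $ v = a * A $ m $ v"
proof -
  have deg2: "max_degree G \<ge> 2" "max_degree G \<noteq> 2" using deg by auto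
  obtain S \<rho> p h where S: "spanning_tree S \<rho> p h" "S \<noteq> UNIV"
    "(\<Sum>s\<in>S. card (nbrs s \<inter> S)) = 2 * (card S - 1)"
    "\<forall>s\<in>S. card (nbrs s) = max_degree G"
    "\<forall>t. t \<notin> S \<longrightarrow> (\<exists>l. nbrs t \<inter> S = {l})"
    "\<forall>t. \<exists>x. \<forall>v. A $ t $ v = (\<Sum>s\<in>S. x s * A $ s $ v)"
    by (rule extremal_set[OF conn deg2(1) extremal])
  note S = S(1-3) S(4)[rule_format] S(5)[rule_format] S(6)[THEN spec]
  have partner: "\<exists>m\<in>S. nbrs m \<inter> S = {l} \<and> (\<exists>a. a \<noteq> 0 \<and> (\<forall>v. A $ t $ v = a * A $ m $ v))"
    if t: "t \<notin> S" "nbrs t \<inter> S = {l}" for t l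
  proof -
    obtain x where "\<forall>w. A $ t $ w = (\<Sum>s\<in>S. x s * A $ s $ w)" using S(6) by blast
    then show ?thesis
      using extremal_outside_vertex(2)[OF S(1,3,4) deg2(1) S(5) _ t card_nbrs_le_max_degree deg2(2)]
      by blast
  qed
  obtain t where t: "t \<notin> S" using S(2) by blast
  then obtain l where l: "nbrs t \<inter> S = {l}" using S(5) by blast
  obtain m a where m: "m \<in> S" "nbrs m \<inter> S = {l}" "a \<noteq> 0" "\<forall>v. A $ t $ v = a * A $ m $ v"
    using partner[OF t l] by blast
  have tm: "nbrs t = nbrs m" by (rule proportional_rows_imp_nbrs_eq[OF m(3,4)])
  have "nbrs m \<noteq> {l}" using S(4)[OF m(1)] deg by auto
  then obtain t' where t': "t' \<in> nbrs m" "t' \<notin> S" using m(2) by blast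
  have "m \<in> nbrs t'" using t'(1) nbrs_sym by blast
  then have m': "nbrs t' \<inter> S = {m}" using S(5)[OF t'(2)] m(1) by (metis IntI singletonD)
  have lm: "l \<in> nbrs m" "l \<in> S" "m \<in> nbrs l" using m(2) nbrs_sym by blast+
  obtain m' where "m' \<in> S" "nbrs m' \<inter> S = {m}" using partner[OF t'(2) m'] by blast
  moreover from this have "m' \<in> nbrs m \<inter> S" using nbrs_sym by blast
  ultimately have l': "nbrs l \<inter> S = {m}" using m(2) by simp
  have rowU: "\<exists>a. a \<noteq> 0 \<and> (\<forall>v. A $ u $ v = a * A $ m $ v)" if u: "u \<in> nbrs l" for u
  proof (cases "u \<in> S")
    case True
    then have "u = m" using u l' by blast
    then show ?thesis by (intro exI[of _ 1]) simp
  next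
    case False
    have "l \<in> nbrs u" using u nbrs_sym by blast
    then have uS: "nbrs u \<inter> S = {l}" using S(5)[OF False] lm(2) by (metis IntI singletonD)
    obtain m'' where m'': "m'' \<in> S" "nbrs m'' \<inter> S = {l}"
      "\<exists>a. a \<noteq> 0 \<and> (\<forall>v. A $ u $ v = a * A $ m'' $ v)"
      using partner[OF False uS] by (elim bexE conjE)
    then have "m'' \<in> nbrs l \<inter> S" using nbrs_sym by blast
    then have "m'' = m" using l' by simp
    then show ?thesis using m''(3) by simp
  qed
  have U: "nbrs u = nbrs m" if "u \<in> nbrs l" for u
    using rowU[OF that] proportional_rows_imp_nbrs_eq by blast
  have V: "nbrs v = nbrs l" if v: "v \<in> nbrs m" for v
  proof (cases "v \<in> S")
    case True
    then have "v = l" using v m(2) by blast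
    then show ?thesis by simp
  next
    case False
    have "m \<in> nbrs v" using v nbrs_sym by blast
    then have vS: "nbrs v \<inter> S = {m}" using S(5)[OF False] m(1) by (metis IntI singletonD)
    obtain l'' a where l'': "l'' \<in> S" "nbrs l'' \<inter> S = {m}" and a: "a \<noteq> 0"
      "\<forall>w. A $ v $ w = a * A $ l'' $ w"
      using partner[OF False vS] by (elim bexE conjE exE)
    then have "l'' \<in> nbrs m \<inter> S" using nbrs_sym by blast
    then have "l'' = l" using m(2) by simp
    then show ?thesis using proportional_rows_imp_nbrs_eq[OF a] by simp
  qed
  show thesis
  proof (rule that[of l "nbrs m" m "nbrs l"])
    show "l \<in> nbrs m" "m \<in> nbrs l" by (fact lm)+
    show "nbrs l \<inter> nbrs m = {}" using U not_self_nbr by blast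
    show "nbrs l \<union> nbrs m = UNIV"
      by (rule connected_closed_imp_UNIV[OF conn, of l]) (use lm U V in blast)+
    show "card (nbrs l) = max_degree G" "card (nbrs m) = max_degree G"
      using S(4) lm m(1) by blast+
  qed (use U V rowU in blast)+
qed

text \<open>
  Since the rows of one side are multiples of a single row, the gains between the two sides have
  the form \<open>\<alpha> u * \<beta> v\<close> with \<open>\<alpha>\<close> and \<open>\<beta>\<close> of modulus one, and switching by \<open>inverse \<circ> \<alpha>\<close> and \<open>\<beta>\<close>
  makes them trivial.
\<close>

lemma extremal_imp_balanced_complete_bipartite:
  assumes conn: "Digraph_Component.connected (with_proj G)" and deg: "max_degree G \<ge> 3"
    and extremal: "CARD('v) = rank A * (max_degree G - 1) + 2"
  shows "CARD('v) = 2 * max_degree G"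
    and "complete_bipartite_digraph (max_degree G) (max_degree G) (with_proj G)"
    and "switching_equivalent G \<phi> (\<lambda>_. 1)"
proof -
  obtain l m U V where UV: "l \<in> V" "m \<in> U" "U \<inter> V = {}" "U \<union> V = UNIV"
    "card U = max_degree G" "card V = max_degree G"
    "\<forall>u\<in>U. nbrs u = V" "\<forall>v\<in>V. nbrs v = U"
    "\<forall>u\<in>U. \<exists>a. \<forall>v. A $ u $ v = a * A $ m $ v"
    by (rule extremal_imp_balanced_bipartite[OF assms])
  note UV = UV(1-6) UV(7)[rule_format] UV(8)[rule_format] UV(9)[THEN bspec]
  show "CARD('v) = 2 * max_degree G"
    using card_Un_disjoint[of U V] UV(3-6) by simp
  have arcs: "(u, v) \<in> parcs G \<longleftrightarrow> u \<in> U \<and> v \<in> V \<or> u \<in> V \<and> v \<in> U" for u v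
    using UV(3,4) UV(7)[of u] UV(8)[of u] by (auto simp: nbrs_def)
  then have "parcs G = U \<times> V \<union> V \<times> U" by auto
  then show "complete_bipartite_digraph (max_degree G) (max_degree G) (with_proj G)"
    unfolding complete_bipartite_digraph_pair_def verts_UNIV
    by (intro conjI exI[of _ U] exI[of _ V]) (use UV(3-6) in simp_all)
  \<comment> \<open>The gains at \<open>l\<close> determine the factors on the side of \<open>m\<close>, as \<open>\<zeta>\<close> is normalised by \<open>\<zeta> m = 1\<close>.\<close>
  define \<zeta> where "\<zeta> i = (if i \<in> U then \<phi> (m, l) / \<phi> (i, l) else \<phi> (m, i))" for i
  have gain_UV: "\<phi> (u, v) = inverse (\<zeta> u) * \<zeta> v" if uv: "u \<in> U" "v \<in> V" for u v
  proof -
    obtain a where a: "\<And>v. A $ u $ v = a * A $ m $ v" using UV(9)[OF uv(1)] by blast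
    have row: "\<phi> (u, w) = a * \<phi> (m, w)" if "w \<in> V" for w
      using a[of w] that UV(7)[OF uv(1)] UV(7)[OF UV(2)] by (simp add: A_nth)
    have "\<phi> (m, l) \<noteq> 0" using UV(1) UV(7)[OF UV(2)] by (intro gain_nonzero) simp
    moreover have "\<phi> (u, l) \<noteq> 0" using UV(1) UV(7)[OF uv(1)] by (intro gain_nonzero) simp
    moreover have "v \<notin> U" using uv UV(3) by blast
    ultimately show ?thesis
      using row[OF uv(2)] row[OF UV(1)] uv by (auto simp: \<zeta>_def field_simps)
  qed
  have "norm (\<zeta> i) = 1" for i
  proof (cases "i \<in> U")
    case True
    then show ?thesis
      using gain_norm[of l m] gain_norm[of l i] UV(1) UV(7)[OF True] UV(7)[OF UV(2)]
      by (simp add: \<zeta>_def norm_divide)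
  next
    case False
    then have "i \<in> nbrs m" using UV(4) UV(7)[OF UV(2)] by blast
    then show ?thesis using gain_norm[of i m] False by (simp add: \<zeta>_def)
  qed
  moreover have "\<phi> (i, j) = inverse (\<zeta> i) * 1 * \<zeta> j" if "(i, j) \<in> parcs G" for i j
  proof -
    have "i \<in> U \<and> j \<in> V \<or> j \<in> U \<and> i \<in> V" using arcs that by blast
    then show ?thesis
    proof
      assume "i \<in> U \<and> j \<in> V"
      then show ?thesis using gain_UV by simp
    next
      assume ji: "j \<in> U \<and> i \<in> V"
      then have "\<phi> (i, j) = inverse (\<phi> (j, i))" using gain_inv[of i j] UV(7) by blast
      then show ?thesis using gain_UV ji by simp
    qed
  qed
  ultimately show "switching_equivalent G \<phi> (\<lambda>_. 1)"
    unfolding switching_equivalent_def by (intro exI[of _ \<zeta>]) auto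
qed

end

section \<open>Cycles\<close>

text \<open>
  The two dependencies express the rows \<open>a\<close> and \<open>b\<close> in terms of the remaining ones.
\<close>

lemma rank_le_if_two_dependencies:
  fixes A :: "'a::field ^ 'n ^ 'm"
  assumes z1: "\<And>j. (\<Sum>i\<in>UNIV. z1 i * A $ i $ j) = 0" "z1 a \<noteq> 0" "z1 b = 0"
    and z2: "\<And>j. (\<Sum>i\<in>UNIV. z2 i * A $ i $ j) = 0" "z2 b \<noteq> 0" "z2 a = 0"
  shows "rank A + 2 \<le> CARD('m)"
proof -
  let ?R = "UNIV - {a, b}"
  let ?W = "(\<lambda>i. row i A) ` ?R"
  have ab: "a \<noteq> b" using z1 by auto
  have in_span: "row c A \<in> vec.span ?W"
    if z: "\<And>j. (\<Sum>i\<in>UNIV. z i * A $ i $ j) = 0" "z c \<noteq> 0"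
      and c: "c \<in> {a, b}" and 0: "\<And>i. i \<in> {a, b} \<Longrightarrow> i \<noteq> c \<Longrightarrow> z i = 0" for z c
  proof -
    have "A $ c $ j = (\<Sum>i\<in>?R. (- z i / z c) * A $ i $ j)" for j
    proof -
      have "(\<Sum>i\<in>UNIV. z i * A $ i $ j) = z c * A $ c $ j + (\<Sum>i\<in>UNIV - {c}. z i * A $ i $ j)"
        by (simp add: sum.remove)
      also have "(\<Sum>i\<in>UNIV - {c}. z i * A $ i $ j) = (\<Sum>i\<in>?R. z i * A $ i $ j)"
        by (rule sum.mono_neutral_right) (use c 0 in auto)
      finally have "A $ c $ j = - (\<Sum>i\<in>?R. z i * A $ i $ j) / z c"
        using z by (simp add: field_simps eq_neg_iff_add_eq_0)
      also have "\<dots> = (\<Sum>i\<in>?R. (- z i / z c) * A $ i $ j)"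
        by (simp add: sum_divide_distrib sum_negf)
      finally show ?thesis .
    qed
    then have "row c A = (\<Sum>i\<in>?R. (- z i / z c) *s row i A)"
      by (simp add: vec_eq_iff row_def)
    moreover have "\<dots> \<in> vec.span ?W"
      by (intro vec.span_sum vec.span_scale vec.span_base imageI)
    ultimately show ?thesis by simp
  qed
  have "rank A \<le> card ?W"
  proof (rule rank_le_card_span)
    fix i
    show "row i A \<in> vec.span ?W"
      using in_span[of z1 a] in_span[of z2 b] z1 z2 by (cases "i \<in> {a, b}") (auto intro: vec.span_base)
  qed simp
  also have "\<dots> \<le> card ?R" by (rule card_image_le) simp
  also have "card ?R = CARD('m) - 2" using ab by (simp add: card_Diff_subset)
  finally have "rank A \<le> CARD('m) - 2" .
  moreover have "2 \<le> CARD('m)" using card_mono[of UNIV "{a, b}"] ab by simp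
  ultimately show ?thesis by simp
qed

context gain_graph
begin

text \<open>
  Take a longest path.  Both neighbours of its last vertex lie on it, and one of them is not its
  predecessor.  That one is the first vertex, because an inner vertex would have three neighbours.
  So the path closes up to a cycle, which is closed under adjacency as all degrees are two.
\<close>

lemma two_regular_imp_cycle:
  assumes conn: "Digraph_Component.connected (with_proj G)" and two: "\<And>v. card (nbrs v) = 2"
  obtains c where "cycle_traversal G CARD('v) c"
proof -
  define is_path where
    "is_path xs \<longleftrightarrow> xs \<noteq> [] \<and> distinct xs \<and> (\<forall>i. Suc i < length xs \<longrightarrow> xs ! Suc i \<in> nbrs (xs ! i))"
    for xs
  have "is_path [undefined]" by (simp add: is_path_def)
  moreover have "length xs < Suc CARD('v)" if "is_path xs" for xs
    using that card_mono[of UNIV "set xs"] by (auto simp: is_path_def distinct_card)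
  ultimately obtain xs where xs: "is_path xs" and longest: "\<And>ys. is_path ys \<Longrightarrow> length ys \<le> length xs"
    using ex_has_greatest_nat[of is_path _ length "Suc CARD('v)"] by (metis less_imp_le)
  define k where "k = length xs"
  have step: "xs ! Suc i \<in> nbrs (xs ! i)" if "Suc i < k" for i
    using xs that by (auto simp: is_path_def k_def)
  have ne: "xs \<noteq> []" and dist: "distinct xs" using xs by (auto simp: is_path_def)
  then have k0: "k > 0" by (simp add: k_def)
  define e where "e = xs ! (k - 1)"
  have e: "e \<in> set xs" using k0 by (simp add: e_def k_def)
  have end_closed: "nbrs e \<subseteq> set xs"
  proof
    fix w assume w: "w \<in> nbrs e"
    show "w \<in> set xs"
    proof (rule ccontr)
      assume "w \<notin> set xs"
      moreover have "(xs @ [w]) ! Suc i \<in> nbrs ((xs @ [w]) ! i)" if "i < k" for i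
      proof (cases "Suc i < k")
        case True
        then show ?thesis using step[of i] by (simp add: nth_append k_def)
      next
        case False
        then have "i = k - 1" using that by simp
        then show ?thesis using w k0 by (simp add: nth_append k_def e_def)
      qed
      ultimately have "is_path (xs @ [w])" using dist by (simp add: is_path_def k_def)
      then show False using longest by fastforce
    qed
  qed
  have inj: "xs ! i = xs ! j \<longleftrightarrow> i = j" if "i < k" "j < k" for i j
    using dist that by (simp add: k_def nth_eq_iff_index_eq)
  have "card (insert e (nbrs e)) = 3" using two[of e] not_self_nbr by simp
  then have k3: "k \<ge> 3"
    using card_mono[of "set xs" "insert e (nbrs e)"] e end_closed distinct_card[OF dist]
    by (simp add: k_def)
  have not_all: "\<not> nbrs e \<subseteq> {xs ! (k - 2)}"
    using card_mono[of "{xs ! (k - 2)}" "nbrs e"] two[of e] by auto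
  then obtain w where w: "w \<in> nbrs e" "w \<noteq> xs ! (k - 2)" by blast
  then obtain j where j: "j < k" "w = xs ! j"
    using end_closed by (metis in_set_conv_nth k_def subsetD)
  \<comment> \<open>Any such neighbour other than the first vertex would have three neighbours on the path.\<close>
  have jne: "j \<noteq> k - 2" "j \<noteq> k - 1" using w j not_self_nbr by (auto simp: e_def)
  have "j = 0"
  proof (rule ccontr)
    assume j0: "j \<noteq> 0"
    have "xs ! (j - 1) \<in> nbrs (xs ! j)" using step[of "j - 1"] j j0 nbrs_sym by simp
    moreover have "xs ! (j + 1) \<in> nbrs (xs ! j)" using step[of j] j jne by simp
    moreover have "e \<in> nbrs (xs ! j)" using w j nbrs_sym by blast
    ultimately have "{xs ! (j - 1), xs ! (j + 1), e} \<subseteq> nbrs (xs ! j)" by blast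
    moreover have "card {xs ! (j - 1), xs ! (j + 1), e} = 3"
    proof -
      have "j - 1 < k" "j + 1 < k" "k - 1 < k" "j - 1 \<noteq> j + 1" "j - 1 \<noteq> k - 1" "j + 1 \<noteq> k - 1"
        using j jne j0 k3 by linarith+
      then have "xs ! (j - 1) \<noteq> xs ! (j + 1)" "xs ! (j - 1) \<noteq> e" "xs ! (j + 1) \<noteq> e"
        unfolding e_def using inj by blast+
      then show ?thesis by simp
    qed
    ultimately have "3 \<le> card (nbrs (xs ! j))" by (metis card_mono finite)
    then show False using two[of "xs ! j"] by simp
  qed
  then have closing: "xs ! 0 \<in> nbrs e" using w j by simp
  have succ: "xs ! (Suc i mod k) \<in> nbrs (xs ! i)" if "i < k" for i
  proof (cases "Suc i < k")
    case True
    then show ?thesis using step by simp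
  next
    case False
    then have "Suc i = k" using that by simp
    then show ?thesis using closing by (auto simp: e_def)
  qed
  have nb: "\<exists>j<k. i = Suc j mod k \<and> nbrs (xs ! i) = {xs ! (Suc i mod k), xs ! j}" if i: "i < k" for i
  proof -
    define j where "j = (if i = 0 then k - 1 else i - 1)"
    have j: "j < k" "i = Suc j mod k" using i k3 by (auto simp: j_def)
    have "xs ! j \<in> nbrs (xs ! i)" using succ[OF j(1)] j(2) nbrs_sym by simp
    moreover have "xs ! (Suc i mod k) \<noteq> xs ! j"
    proof -
      have "Suc i mod k \<noteq> j" using i k3 by (auto simp: j_def mod_Suc)
      moreover have "Suc i mod k < k" using k0 by simp
      ultimately show ?thesis using inj j(1) by blast
    qed
    ultimately have "{xs ! (Suc i mod k), xs ! j} = nbrs (xs ! i)"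
      using succ[OF i] two[of "xs ! i"] by (intro card_subset_eq) auto
    then show ?thesis using j by blast
  qed
  have "set xs = UNIV"
  proof (rule connected_closed_imp_UNIV[OF conn e])
    fix v assume "v \<in> set xs"
    then obtain i where "i < k" "v = xs ! i" by (metis in_set_conv_nth k_def)
    then show "nbrs v \<subseteq> set xs" using nb[of i] k0 by (auto simp: k_def)
  qed
  then have k: "k = CARD('v)" using distinct_card[OF dist] by (simp add: k_def)
  have "cycle_traversal G k ((!) xs)"
    unfolding cycle_traversal_def
  proof (intro conjI k3)
    show "bij_betw ((!) xs) {..<k} (pverts G)"
      using bij_betw_nth[OF dist] \<open>set xs = UNIV\<close> by (simp add: k_def verts_UNIV)
    show "parcs G = (\<Union>i<k. {(xs ! i, xs ! (Suc i mod k)), (xs ! (Suc i mod k), xs ! i)})"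
    proof (intro subset_antisym subsetI)
      fix a assume a: "a \<in> parcs G"
      obtain u v where uv: "a = (u, v)" by (cases a)
      obtain i where i: "i < k" "u = xs ! i"
        using \<open>set xs = UNIV\<close> by (metis UNIV_I in_set_conv_nth k_def)
      then obtain j where "j < k" "i = Suc j mod k" "v \<in> {xs ! (Suc i mod k), xs ! j}"
        using nb[OF i(1)] a uv by (auto simp: nbrs_def)
      then show "a \<in> (\<Union>i<k. {(xs ! i, xs ! (Suc i mod k)), (xs ! (Suc i mod k), xs ! i)})"
        using uv i by auto
    next
      fix a assume "a \<in> (\<Union>i<k. {(xs ! i, xs ! (Suc i mod k)), (xs ! (Suc i mod k), xs ! i)})"
      then obtain i where "i < k"
        "a = (xs ! i, xs ! (Suc i mod k)) \<or> a = (xs ! (Suc i mod k), xs ! i)" by blast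
      then show "a \<in> parcs G"
        using succ[of i] nbrs_sym[of "xs ! (Suc i mod k)" "xs ! i"] by (auto simp: nbrs_def)
    qed
  qed
  then show thesis using that k by blast
qed

end

locale cycle_gain_graph = gain_graph G \<phi>
  for G :: "('v::finite) pair_pre_digraph" and \<phi> +
  fixes n :: nat and c :: "nat \<Rightarrow> 'v"
  assumes traversal: "cycle_traversal G n c"
begin

lemma n3: "n \<ge> 3" and bij: "bij_betw c {..<n} UNIV"
  using traversal by (auto simp: cycle_traversal_def verts_UNIV)

lemma card_verts: "CARD('v) = n"
  using bij_betw_same_card[OF bij] by simp

lemma c_eq_iff: "i < n \<Longrightarrow> j < n \<Longrightarrow> c i = c j \<longleftrightarrow> i = j"
  using bij by (auto simp: bij_betw_def inj_on_def)

lemma vertex_cases: obtains i where "i < n" "v = c i"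
  using bij by (metis UNIV_I bij_betw_imp_surj_on imageE lessThan_iff)

text \<open>
  The position before \<open>i\<close> is given by an index \<open>j\<close> with \<open>i = Suc j mod n\<close>, which avoids truncated
  subtraction and a case distinction for \<open>i = 0\<close>.
\<close>

lemma nbrs_cycle:
  assumes "j < n" and "i = Suc j mod n"
  shows "nbrs (c i) = {c (Suc i mod n), c j}" and "c (Suc i mod n) \<noteq> c j"
proof -
  have i: "i < n" using assms n3 by simp
  have arc: "(u, v) \<in> parcs G \<longleftrightarrow>
      (\<exists>k<n. u = c k \<and> v = c (Suc k mod n) \<or> u = c (Suc k mod n) \<and> v = c k)" for u v
    using traversal by (auto simp: cycle_traversal_def)
  have lt: "Suc k mod n < n" for k using n3 by simp
  have inj: "k = j" if "k < n" "Suc k mod n = i" for k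
    using that assms by (auto simp: mod_Suc split: if_splits)
  have "v \<in> nbrs (c i) \<longleftrightarrow> v = c (Suc i mod n) \<or> v = c j" for v
  proof
    assume "v \<in> nbrs (c i)"
    then obtain k where k: "k < n"
      "c i = c k \<and> v = c (Suc k mod n) \<or> c i = c (Suc k mod n) \<and> v = c k"
      unfolding nbrs_def using arc by blast
    then show "v = c (Suc i mod n) \<or> v = c j"
      using c_eq_iff[OF i k(1)] c_eq_iff[OF i lt] inj by metis
  next
    assume "v = c (Suc i mod n) \<or> v = c j"
    then show "v \<in> nbrs (c i)"
      unfolding nbrs_def using arc i assms by blast
  qed
  then show "nbrs (c i) = {c (Suc i mod n), c j}" by blast
  have "Suc i mod n \<noteq> j" using assms n3 by (auto simp: mod_Suc)
  then show "c (Suc i mod n) \<noteq> c j" using c_eq_iff[OF lt assms(1)] by blast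
qed

lemma max_degree_cycle: "max_degree G = 2"
proof (rule max_degree_regular)
  fix v
  obtain i where i: "i < n" "v = c i" by (rule vertex_cases)
  define j where "j = (if i = 0 then n - 1 else i - 1)"
  have "j < n" "i = Suc j mod n" using i n3 by (auto simp: j_def)
  from nbrs_cycle[OF this] show "card (nbrs v) = 2" using i by simp
qed

definition step_gain :: "nat \<Rightarrow> complex" where
  "step_gain i = \<phi> (c i, c (Suc i mod n))"

text \<open>
  These products are the gauge that trivialises all gains of the cycle except the one that leads
  from \<open>c (n - 1)\<close> back to \<open>c 0\<close>, which becomes the gain of the whole cycle.
\<close>

definition path_gain :: "nat \<Rightarrow> complex" where
  "path_gain i = (\<Prod>k<i. step_gain k)"

lemma step_gain_nonzero: "i < n \<Longrightarrow> step_gain i \<noteq> 0"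
proof -
  assume i: "i < n"
  have "c i \<in> nbrs (c (Suc i mod n))" using nbrs_cycle(1)[OF i refl] by blast
  then show ?thesis unfolding step_gain_def using gain_nonzero nbrs_sym by blast
qed

lemma reverse_step_gain: "i < n \<Longrightarrow> \<phi> (c (Suc i mod n), c i) = inverse (step_gain i)"
  unfolding step_gain_def
  by (rule gain_inv) (use nbrs_cycle(1)[OF _ refl, of i] nbrs_sym in blast)

lemma path_gain_0: "path_gain 0 = 1" and path_gain_Suc: "path_gain (Suc i) = path_gain i * step_gain i"
  by (simp_all add: path_gain_def)

lemma path_gain_nonzero: "i \<le> n \<Longrightarrow> path_gain i \<noteq> 0"
  using step_gain_nonzero by (auto simp: path_gain_def)

lemma path_gain_n: "path_gain n = cycle_gain \<phi> n c"
  by (simp add: path_gain_def cycle_gain_def step_gain_def)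

lemma column_sum:
  assumes "j < n" and "i = Suc j mod n"
  shows "(\<Sum>v\<in>UNIV. z v * A $ v $ c i) =
    z (c j) * step_gain j + z (c (Suc i mod n)) * inverse (step_gain i)"
proof -
  have i: "i < n" using assms n3 by simp
  note nb = nbrs_cycle[OF assms]
  have "(\<Sum>v\<in>UNIV. z v * A $ v $ c i) = (\<Sum>v\<in>nbrs (c i). z v * A $ v $ c i)"
    by (rule sum.mono_neutral_right) (use nbrs_sym A_nth_eq_0_iff in auto)
  also have "\<dots> = (\<Sum>v\<in>nbrs (c i). z v * \<phi> (v, c i))"
    by (rule sum.cong) (use nbrs_sym in \<open>auto simp: A_nth\<close>)
  also have "\<dots> = z (c (Suc i mod n)) * \<phi> (c (Suc i mod n), c i) + z (c j) * \<phi> (c j, c i)"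
    unfolding nb(1) using nb(2) by simp
  finally show ?thesis using reverse_step_gain[OF i] assms(2) by (simp add: step_gain_def)
qed

text \<open>
  In the gauge \<open>y\<close> the left kernel of the adjacency matrix is the recursion
  \<open>y (j + 2) = - y j\<close> of an ungauged path, from the columns of the inner vertices, together with
  two closing conditions, from the columns of \<open>c (n - 1)\<close> and \<open>c 0\<close>, that carry the cycle gain.
\<close>

lemma dependency_gauged:
  assumes z: "\<And>i. i < n \<Longrightarrow> z (c i) = y i * path_gain i"
  shows "(\<forall>j. (\<Sum>v\<in>UNIV. z v * A $ v $ j) = 0) \<longleftrightarrow>
    (\<forall>j. j + 2 < n \<longrightarrow> y (j + 2) = - y j) \<and>
    y 0 = - y (n - 2) * cycle_gain \<phi> n c \<and> y 1 = - y (n - 1) * cycle_gain \<phi> n c"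
    (is "?L \<longleftrightarrow> ?R")
proof -
  let ?C = "\<lambda>i. \<Sum>v\<in>UNIV. z v * A $ v $ c i"
  have inner: "?C (j + 1) = 0 \<longleftrightarrow> y (j + 2) = - y j" if j: "j + 2 < n" for j
  proof -
    have "?C (j + 1) = z (c j) * step_gain j + z (c (j + 2)) * inverse (step_gain (j + 1))"
      using column_sum[of j "j + 1" z] j by simp
    also have "\<dots> = (y j + y (j + 2)) * path_gain (j + 1)"
      using j step_gain_nonzero[of "j + 1"]
      by (simp add: z path_gain_Suc algebra_simps)
    finally show ?thesis
      using path_gain_nonzero[of "j + 1"] j by (simp add: add_eq_0_iff)
  qed
  have last: "path_gain (n - 1) * step_gain (n - 1) = cycle_gain \<phi> n c"
    using path_gain_Suc[of "n - 1"] path_gain_n n3 by simp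
  have "?C 0 = z (c (n - 1)) * step_gain (n - 1) + z (c 1) * inverse (step_gain 0)"
    using column_sum[of "n - 1" 0 z] n3 by simp
  also have "\<dots> = y (n - 1) * cycle_gain \<phi> n c + y 1"
    using n3 step_gain_nonzero[of 0] path_gain_Suc[of 0] path_gain_0
    by (simp add: z last[symmetric])
  finally have first_col: "?C 0 = 0 \<longleftrightarrow> y 1 = - y (n - 1) * cycle_gain \<phi> n c"
    by (simp add: add_eq_0_iff)
  have sg: "step_gain (n - 1) \<noteq> 0" using step_gain_nonzero n3 by simp
  have nn: "Suc (n - 2) = n - 1" "Suc (n - 1) = n" using n3 by simp_all
  have "?C (n - 1) = z (c (n - 2)) * step_gain (n - 2) + z (c 0) * inverse (step_gain (n - 1))"
    using column_sum[of "n - 2" "n - 1" z] n3 nn by simp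
  also have "\<dots> = y (n - 2) * path_gain (n - 1) + y 0 * inverse (step_gain (n - 1))"
    using n3 path_gain_Suc[of "n - 2"] nn by (simp add: z path_gain_0)
  also have "\<dots> = (y (n - 2) * cycle_gain \<phi> n c + y 0) * inverse (step_gain (n - 1))"
    using sg by (simp add: last[symmetric] field_simps)
  finally have last_col: "?C (n - 1) = 0 \<longleftrightarrow> y 0 = - y (n - 2) * cycle_gain \<phi> n c"
    using sg by (simp add: add_eq_0_iff)
  have "(\<Sum>v\<in>UNIV. z v * A $ v $ j) = 0" if "\<forall>i<n. ?C i = 0" for j
  proof -
    obtain i where "i < n" "j = c i" by (rule vertex_cases)
    then show ?thesis using that by simp
  qed
  then have "?L \<longleftrightarrow> (\<forall>i<n. ?C i = 0)" by blast
  also have "\<dots> \<longleftrightarrow> (\<forall>j. j + 2 < n \<longrightarrow> ?C (j + 1) = 0) \<and> ?C (n - 1) = 0 \<and> ?C 0 = 0"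
  proof (intro iffI allI impI)
    fix i assume R: "(\<forall>j. j + 2 < n \<longrightarrow> ?C (j + 1) = 0) \<and> ?C (n - 1) = 0 \<and> ?C 0 = 0" and i: "i < n"
    consider "i = 0" | "i = n - 1" | j where "i = j + 1" "j + 2 < n"
      using i by (cases i) force+
    then show "?C i = 0" using R by cases auto
  qed (use n3 in auto)
  also have "\<dots> \<longleftrightarrow> ?R" using inner first_col last_col by simp
  finally show ?thesis .
qed

text \<open>
  A kernel of dimension two contains a vector with \<open>y 0 = 0\<close>, which by the recursion lives on the
  odd positions and alternates in sign there.  It can satisfy the closing condition at \<open>c 0\<close> only
  if \<open>n - 1\<close> is odd and the cycle gain compensates for the sign picked up along the way.
\<close>

lemma singular_imp_cycle_gain:
  assumes "rank A + 2 \<le> n"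
  shows "even n" and "cycle_gain \<phi> n c = (-1) ^ (n div 2)"
proof -
  obtain z where z: "z (c 0) = 0" "z \<noteq> (\<lambda>_. 0)" "\<And>j. (\<Sum>v\<in>UNIV. z v * A $ v $ j) = 0"
    using row_dependency_vanishing_at[of A "c 0"] assms card_verts by auto
  define y where "y i = z (c i) / path_gain i" for i
  have zy: "z (c i) = y i * path_gain i" if "i < n" for i
    using path_gain_nonzero[of i] that by (simp add: y_def)
  have closing: "y 1 = - y (n - 1) * cycle_gain \<phi> n c"
    and "\<forall>j. j + 2 < n \<longrightarrow> y (j + 2) = - y j"
    using dependency_gauged[of z y, OF zy] z(3) by blast+
  then have rec: "y (j + 2) = - y j" if "j + 2 < n" for j using that by blast
  have y0: "y 0 = 0" using z by (simp add: y_def)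
  have evens: "2 * k < n \<Longrightarrow> y (2 * k) = 0" for k
  proof (induction k)
    case (Suc k)
    then show ?case using rec[of "2 * k"] by simp
  qed (simp add: y0)
  have odds: "2 * k + 1 < n \<Longrightarrow> y (2 * k + 1) = (-1) ^ k * y 1" for k
  proof (induction k)
    case (Suc k)
    then show ?case using rec[of "2 * k + 1"] by simp
  qed simp
  have y1: "y 1 \<noteq> 0"
  proof
    assume "y 1 = 0"
    have "z v = 0" for v
    proof -
      obtain i where i: "i < n" "v = c i" by (rule vertex_cases)
      have "y i = 0"
        using evens[of "i div 2"] odds[of "i div 2"] \<open>y 1 = 0\<close> i
        by (cases "even i") (auto elim!: evenE oddE)
      then show ?thesis using zy i by simp
    qed
    then show False using z(2) by blast
  qed
  show even: "even n"
  proof (rule ccontr)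
    assume "odd n"
    then obtain k where "n = 2 * k + 1" by (rule oddE)
    then have "y (n - 1) = 0" using evens[of k] by simp
    then show False using closing y1 by simp
  qed
  then obtain m where m: "n = 2 * m" by (rule evenE)
  then obtain k where k: "m = Suc k" using n3 by (cases m) auto
  have "y (n - 1) = (-1) ^ k * y 1" using odds[of k] m k by simp
  then have y1_eq: "y 1 = - ((-1) ^ k * y 1) * cycle_gain \<phi> n c" using closing by metis
  have "y 1 * (1 + (-1) ^ k * cycle_gain \<phi> n c) = y 1 - (- ((-1) ^ k * y 1) * cycle_gain \<phi> n c)"
    by (simp add: algebra_simps)
  also have "\<dots> = 0" using y1_eq by (metis right_minus_eq)
  finally have "y 1 * (1 + (-1) ^ k * cycle_gain \<phi> n c) = 0" .
  then have "1 + (-1) ^ k * cycle_gain \<phi> n c = 0" using y1 by simp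
  then have "(-1) ^ k * (1 + (-1) ^ k * cycle_gain \<phi> n c) = 0" by simp
  then have "(-1) ^ k + cycle_gain \<phi> n c = 0"
    by (simp add: distrib_left flip: mult.assoc power_add mult_2)
  then show "cycle_gain \<phi> n c = (-1) ^ (n div 2)"
    using m k by (simp add: add_eq_0_iff)
qed

text \<open>
  Conversely, the sequences that alternate in sign on the even and on the odd positions,
  respectively, both close up.  Their supports are disjoint, so they are independent.
\<close>

lemma cycle_gain_imp_singular:
  assumes "even n" and gain: "cycle_gain \<phi> n c = (-1) ^ (n div 2)"
  shows "rank A + 2 \<le> n"
proof -
  obtain m where m: "n = 2 * m" using assms(1) by (rule evenE)
  then obtain k where k: "m = Suc k" using n3 by (cases m) auto
  have n: "n - 2 = 2 * k" "n - 1 = Suc (2 * k)" "n div 2 = Suc k" using m k by simp_all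
  have sq: "(-1 :: complex) ^ k * (-1) ^ k = 1"
    by (simp flip: power_add mult_2)
  \<comment> \<open>The parameter \<open>b\<close> selects the even or the odd positions.\<close>
  define y where "y b i = (if even i = b then (-1) ^ (i div 2) else (0 :: complex))" for b i
  define z where "z b v = (let i = inv_into {..<n} c v in y b i * path_gain i)" for b v
  have zy: "z b (c i) = y b i * path_gain i" if "i < n" for b i
    using that bij by (simp add: z_def bij_betw_def)
  have "(\<forall>j. j + 2 < n \<longrightarrow> y b (j + 2) = - y b j) \<and>
    y b 0 = - y b (n - 2) * cycle_gain \<phi> n c \<and> y b 1 = - y b (n - 1) * cycle_gain \<phi> n c" for b
    unfolding n gain by (cases b) (simp_all add: y_def sq)
  then have dep: "(\<Sum>v\<in>UNIV. z b v * A $ v $ j) = 0" for b j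
    using dependency_gauged[of "z b" "y b", OF zy] by blast
  have ends: "z b (c i) = 0 \<longleftrightarrow> even i \<noteq> b" if "i < n" for b i
    using zy[OF that] path_gain_nonzero[of i] that by (simp add: y_def)
  have "rank A + 2 \<le> CARD('v)"
    by (rule rank_le_if_two_dependencies[of "z True" A "c (2 * k)" "c (Suc (2 * k))" "z False"])
      (use m k in \<open>simp_all add: dep ends\<close>)
  then show ?thesis using card_verts by simp
qed

end

section \<open>Balanced complete bipartite graphs\<close>

context gain_graph
begin

text \<open>
  Up to the factor \<open>inverse (\<zeta> i)\<close> the row of \<open>i\<close> depends only on the side to which \<open>i\<close> belongs.
\<close>

lemma balanced_complete_bipartite:
  assumes K: "complete_bipartite_digraph k k (with_proj G)"
    and balanced: "switching_equivalent G \<phi> (\<lambda>_. 1)"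
  shows "CARD('v) = 2 * k" and "max_degree G = k" and "rank A \<le> 2"
proof -
  obtain U V where UV: "UNIV = U \<union> V" "U \<inter> V = {}" "card U = k" "card V = k"
    and arcs: "parcs G = U \<times> V \<union> V \<times> U"
    using K unfolding complete_bipartite_digraph_pair_def verts_UNIV by blast
  show "CARD('v) = 2 * k" using card_Un_disjoint[of U V] UV by simp
  have nb: "nbrs i = (if i \<in> U then V else U)" for i
    using arcs UV(1,2) by (auto simp: nbrs_def)
  then show "max_degree G = k" using UV by (intro max_degree_regular) simp
  obtain \<zeta> where \<zeta>: "\<forall>(i, j)\<in>parcs G. \<phi> (i, j) = inverse (\<zeta> i) * 1 * \<zeta> j"
    using balanced unfolding switching_equivalent_def by blast
  have gain: "\<phi> (i, j) = inverse (\<zeta> i) * \<zeta> j" if "j \<in> nbrs i" for i j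
    using bspec[OF \<zeta>, of "(i, j)"] that by (simp add: nbrs_def)
  define b :: "'v set \<Rightarrow> complex ^ 'v" where "b W = (\<chi> j. if j \<in> W then \<zeta> j else 0)" for W
  have "row i A = inverse (\<zeta> i) *s b (nbrs i)" for i
    using gain by (simp add: vec_eq_iff row_def b_def A_nth)
  moreover have "b (nbrs i) \<in> {b U, b V}" for i using nb by simp
  ultimately have "row i A \<in> vec.span {b U, b V}" for i
    by (metis vec.span_base vec.span_scale)
  then have "rank A \<le> card {b U, b V}" by (rule rank_le_card_span) simp
  also have "\<dots> \<le> 2" by (simp add: card_insert_if)
  finally show "rank A \<le> 2" .
qed

end

section \<open>The rank bound\<close>

theorem theorem4p1:
  fixes G :: "('v::finite) pair_pre_digraph"
    and \<phi> :: "'v \<times> 'v \<Rightarrow> complex"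
    and n \<Delta> r :: nat
  assumes "gain_graph G \<phi>"
    and "Digraph_Component.connected (with_proj G)"
    and "n = card (pverts G)"
    and "\<Delta> = max_degree G"
    and "\<Delta> \<ge> 2"
    and "r = rank (adjacency_matrix G \<phi>)"
  shows "real r \<ge> (real n - 2) / (real \<Delta> - 1) \<and>
    (real r = (real n - 2) / (real \<Delta> - 1) \<longleftrightarrow>
       (even n \<and> complete_bipartite_digraph (n div 2) (n div 2) (with_proj G) \<and>
          switching_equivalent G \<phi> (\<lambda>_. 1)) \<or>
       (even n \<and> (\<exists>c. cycle_traversal G n c \<and> cycle_gain \<phi> n c = (-1) ^ (n div 2))))"
    (is "?bound \<and> (?extremal \<longleftrightarrow> ?K \<or> ?C)")
proof -
  interpret gain_graph G \<phi> by fact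
  note conn = assms(2)
  have n: "n = CARD('v)" using assms(3) verts_UNIV by simp
  have deg: "max_degree G \<ge> 2" "max_degree G \<ge> 1" using assms(4,5) by simp_all
  have bound: "n \<le> r * (\<Delta> - 1) + 2"
    using card_verts_le_rank_mult[OF conn deg(2)] n assms(4,6) by simp
  have real: "real (r * (\<Delta> - 1) + 2) = real r * (real \<Delta> - 1) + 2" "real \<Delta> - 1 > 0"
    using assms(5) by (simp_all add: of_nat_diff)
  have ?bound
    using of_nat_mono[OF bound, where 'a = real] real by (simp add: pos_divide_le_eq)
  moreover have extremal_iff: "?extremal \<longleftrightarrow> n = r * (\<Delta> - 1) + 2"
  proof -
    have "?extremal \<longleftrightarrow> real n = real (r * (\<Delta> - 1) + 2)"
      using real by (auto simp: field_simps)
    then show ?thesis by (simp only: of_nat_eq_iff)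
  qed
  moreover have "?K \<or> ?C" if "n = r * (\<Delta> - 1) + 2"
  proof -
    have ext: "CARD('v) = rank A * (max_degree G - 1) + 2" using that n assms(4,6) by simp
    show ?thesis
    proof (cases "\<Delta> = 2")
      case True
      obtain c where c: "cycle_traversal G CARD('v) c"
        by (rule two_regular_imp_cycle[OF conn])
          (use extremal_imp_regular[OF conn deg(1) ext] True assms(4) in simp)
      interpret cycle_gain_graph G \<phi> n c by unfold_locales (use c n in simp)
      have "rank A + 2 \<le> n" using that True assms(6) by simp
      then show ?thesis using singular_imp_cycle_gain traversal by blast
    next
      case False
      then have "max_degree G \<ge> 3" using assms(4,5) by simp
      from extremal_imp_balanced_complete_bipartite[OF conn this ext]
      show ?thesis using n by auto
    qed
  qed
  moreover have "n = r * (\<Delta> - 1) + 2" if "?K \<or> ?C"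
    using that
  proof
    assume ?K
    then obtain k where k: "n = 2 * k" and K: "complete_bipartite_digraph k k (with_proj G)"
      "switching_equivalent G \<phi> (\<lambda>_. 1)"
      by (auto elim: evenE)
    have "r * (\<Delta> - 1) + 2 \<le> 2 * (\<Delta> - 1) + 2"
      using balanced_complete_bipartite(3)[OF K] assms(6) by simp
    also have "\<dots> = n"
      using balanced_complete_bipartite(2)[OF K] k assms(4,5) by simp
    finally show ?thesis using bound by simp
  next
    assume ?C
    then obtain c where "even n" "cycle_traversal G n c" and g: "cycle_gain \<phi> n c = (-1) ^ (n div 2)"
      by blast
    then interpret cycle_gain_graph G \<phi> n c by unfold_locales
    have "rank A + 2 \<le> n" by (rule cycle_gain_imp_singular) fact+
    then show ?thesis using bound max_degree_cycle assms(4,6) by simp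
  qed
  ultimately show ?thesis by blast
qed

end
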